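(* Consider a finite average-reward MDP satisfying the assumptions in the context. For any policy $\pi\in\Pi$, there exist constants $C_m,C_p,C_r,\kappa_r\in\mathbb R^+$, determined by the underlying MDP (with the expressions given in the context), such that the average reward $\rho^\pi$ is $L_2^\Pi$-smooth: $$\left|\left\langle\pi'-\pi,\frac{\partial^2\rho^\pi}{\partial\pi^2}(\pi'-\pi)\right\rangle\right|\le \frac{L_2^\Pi}{2}\,\|\pi'-\pi\|_2^2\qquad\text{for all }\pi,\pi'\in\Pi,$$ where $$L_2^\Pi=4\left(C_p^2C_m^2\kappa_r+C_pC_mC_r+(C_p+1)(C_m^2C_p\kappa_r+C_mC_r)+4(C_m^3C_p^2\kappa_r+C_m^2C_pC_r)\right).$$
   Context: The MDP has finite state space $\mathcal S$, finite action space $\mathcal A$, transition kernel $\mathbb P(s'|s,a)$, and reward $r:\mathcal S\times\mathcal A\to\mathbb R$ with $|r(s,a)|\in[0,1]$. $\Pi$ is the set of randomized policies $\pi:\mathcal S\to\Delta\mathcal A$, viewed as a subset of $\mathbb R^{\mathcal S\times\mathcal A}$ with Euclidean norm $\|\cdot\|_2$. For $\pi\in\Pi$: $\mathbb P^\pi(s'|s)=\sum_a\pi(a|s)\mathbb P(s'|s,a)$, $r^\pi(s)=\sum_a\pi(a|s)r(s,a)$. Assumption: for every $\pi\in\Pi$ the Markov chain with transition matrix $\mathbb P^\pi$ is irreducible and aperiodic, with stationary distribution $d^\pi$; this also means that there are constants $C_e<\infty$ and $\lambda\in[0,1)$ with $\|(\mathbb P^\pi)^k-\mathbf 1(d^\pi)^\top\|_\infty\le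 C_e\lambda^k$ for all $k\in\mathbb N$, $\pi\in\Pi$, where $\mathbf 1$ is the all-ones vector. The average reward is $\rho^\pi=\sum_s d^\pi(s)r^\pi(s)$. The quantity $\langle\pi'-\pi,\frac{\partial^2\rho^\pi}{\partial\pi^2}(\pi'-\pi)\rangle$ is the second directional derivative of $\rho$ at $\pi$ in the direction $\pi'-\pi$, i.e. the second derivative in $\alpha$ of $\rho^{(1-\alpha)\pi+\alpha\pi'}$ at $\alpha=0$. Constants: $\Phi=I-\frac{\mathbf 1\mathbf 1^\top}{|\mathcal S|}$; matrix norms $\|\cdot\|$ are operator norms induced by $\|\cdot\|_\infty$. $C_m=\max_{\pi\in\Pi}\|(I-\Phi\mathbb P^\pi)^{-1}\|$; $C_p=\max_{\pi,\pi'\in\Pi}\frac{\|\mathbb P^{\pi'}-\mathbb P^\pi\|}{\|\pi'-\pi\|_2}$; $C_r=\max_{\pi,\pi'\in\Pi}\frac{\|r^{\pi'}-r^\pi\|_\infty}{\|\pi'-\pi\|_2}$ (both maxima over $\pi\ne\pi'$); $\kappa_r=\max_{\pi\in\Pi}\|\Phi r^\pi\|_\infty$. *)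

theory Defs
  imports "HOL-Analysis.Analysis" "HOL-Probability.Probability_Mass_Function"
begin

text \<open>The class instance of \<open>^\<close> on \<open>real^'n^'n\<close> is the entrywise power, so powers of
  matrices with respect to \<open>**\<close> need their own definition.\<close>

primrec mat_power :: "real^'n^'n \<Rightarrow> nat \<Rightarrow> real^'n^'n" where
  "mat_power A 0 = mat 1"
| "mat_power A (Suc k) = A ** mat_power A k"

text \<open>The operator norm induced by the maximum norm. The library constant \<open>onorm\<close> has the same
  shape, but uses the Euclidean norm. The point \<open>x = 0\<close> contributes the harmless value \<open>0/0 = 0\<close>.\<close>

definition opnorm_inf :: "real^'n^'n \<Rightarrow> real" where
  "opnorm_inf A = (SUP x. infnorm (A *v x) / infnorm x)"

definition irreducible_chain :: "real^'s^'s \<Rightarrow> bool" where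
  "irreducible_chain Q \<longleftrightarrow> (\<forall>i j. \<exists>k. mat_power Q k $ i $ j > 0)"

definition aperiodic_chain :: "real^'s^'s \<Rightarrow> bool" where
  "aperiodic_chain Q \<longleftrightarrow> (\<forall>i. Gcd {k. 0 < k \<and> mat_power Q k $ i $ i > 0} = 1)"

definition is_stationary :: "real^'s^'s \<Rightarrow> real^'s \<Rightarrow> bool" where
  "is_stationary Q d \<longleftrightarrow> (\<forall>s. 0 \<le> d $ s) \<and> (\<Sum>s\<in>UNIV. d $ s) = 1 \<and> d v* Q = d"

definition stationary_distribution :: "real^'s^'s \<Rightarrow> real^'s" where
  "stationary_distribution Q = (THE d. is_stationary Q d)"

text \<open>States and actions are finite types, \<open>K s a\<close> is the distribution of the next
  state, and \<open>\<pi> $ (s, a)\<close> is the probability \<open>\<pi>(a|s)\<close>.\<close>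

definition policies :: "(real^('s::finite \<times> 'a::finite)) set" where
  "policies = {\<pi>. (\<forall>s a. 0 \<le> \<pi> $ (s, a)) \<and> (\<forall>s. (\<Sum>a\<in>UNIV. \<pi> $ (s, a)) = 1)}"

definition policy_kernel ::
    "('s::finite \<Rightarrow> 'a::finite \<Rightarrow> 's pmf) \<Rightarrow> real^('s \<times> 'a) \<Rightarrow> real^'s^'s" where
  "policy_kernel K \<pi> = (\<chi> s s'. \<Sum>a\<in>UNIV. \<pi> $ (s, a) * pmf (K s a) s')"

definition policy_reward ::
    "('s::finite \<Rightarrow> 'a::finite \<Rightarrow> real) \<Rightarrow> real^('s \<times> 'a) \<Rightarrow> real^'s" where
  "policy_reward r \<pi> = (\<chi> s. \<Sum>a\<in>UNIV. \<pi> $ (s, a) * r s a)"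

definition average_reward ::
    "('s::finite \<Rightarrow> 'a::finite \<Rightarrow> 's pmf) \<Rightarrow> ('s \<Rightarrow> 'a \<Rightarrow> real) \<Rightarrow> real^('s \<times> 'a) \<Rightarrow> real" where
  "average_reward K r \<pi> =
     (\<Sum>s\<in>UNIV. stationary_distribution (policy_kernel K \<pi>) $ s * policy_reward r \<pi> $ s)"

text \<open>The restriction of \<open>f\<close> to the segment from \<open>x\<close> to \<open>y\<close>. A point of the policy polytope may lie on
  its boundary, so that only parameters in \<open>{0..1}\<close> are guaranteed to stay inside; all derivatives
  are therefore taken within \<open>{0..1}\<close>, which makes them one-sided at \<open>0\<close>.\<close>

definition along_segment :: "('v::real_vector \<Rightarrow> real) \<Rightarrow> 'v \<Rightarrow> 'v \<Rightarrow> real \<Rightarrow> real" where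
  "along_segment f x y \<alpha> = f ((1 - \<alpha>) *\<^sub>R x + \<alpha> *\<^sub>R y)"

definition segment_deriv :: "('v::real_vector \<Rightarrow> real) \<Rightarrow> 'v \<Rightarrow> 'v \<Rightarrow> real \<Rightarrow> real" where
  "segment_deriv f x y \<alpha> = vector_derivative (along_segment f x y) (at \<alpha> within {0..1})"

definition second_dir_deriv :: "('v::real_vector \<Rightarrow> real) \<Rightarrow> 'v \<Rightarrow> 'v \<Rightarrow> real" where
  "second_dir_deriv f x y = vector_derivative (segment_deriv f x y) (at 0 within {0..1})"

text \<open>The condition under which \<open>second_dir_deriv f x y\<close> is a genuine derivative.\<close>

definition has_second_dir_deriv :: "('v::real_vector \<Rightarrow> real) \<Rightarrow> 'v \<Rightarrow> 'v \<Rightarrow> bool" where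
  "has_second_dir_deriv f x y \<longleftrightarrow>
     along_segment f x y differentiable_on {0..1} \<and>
     segment_deriv f x y differentiable (at 0 within {0..1})"

definition centering :: "real^'s^'s" where
  "centering = mat 1 - (\<chi> i j. 1 / real CARD('s))"

text \<open>\<open>is_max S m\<close> says that the maximum of \<open>S\<close> is attained and equals \<open>m\<close>. The maximum of the empty
  set is \<open>0\<close> by convention; this occurs only for the two sets of difference quotients below, and
  only when there is a single action and hence a single policy.\<close>

definition is_max :: "real set \<Rightarrow> real \<Rightarrow> bool" where
  "is_max S m \<longleftrightarrow> (if S = {} then m = 0 else m \<in> S \<and> (\<forall>x\<in>S. x \<le> m))"

definition resolvent_norms ::
    "('s::finite \<Rightarrow> 'a::finite \<Rightarrow> 's pmf) \<Rightarrow> real set" where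
  "resolvent_norms K =
     {opnorm_inf (matrix_inv (mat 1 - centering ** policy_kernel K \<pi>)) | \<pi>. \<pi> \<in> policies}"

definition kernel_quotients ::
    "('s::finite \<Rightarrow> 'a::finite \<Rightarrow> 's pmf) \<Rightarrow> real set" where
  "kernel_quotients K =
     {opnorm_inf (policy_kernel K \<pi>' - policy_kernel K \<pi>) / norm (\<pi>' - \<pi>) | \<pi> \<pi>'.
        \<pi> \<in> policies \<and> \<pi>' \<in> policies \<and> \<pi> \<noteq> \<pi>'}"

definition reward_quotients ::
    "('s::finite \<Rightarrow> 'a::finite \<Rightarrow> real) \<Rightarrow> real set" where
  "reward_quotients r =
     {infnorm (policy_reward r \<pi>' - policy_reward r \<pi>) / norm (\<pi>' - \<pi>) | \<pi> \<pi>'.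
        \<pi> \<in> policies \<and> \<pi>' \<in> policies \<and> \<pi> \<noteq> \<pi>'}"

definition centered_reward_norms ::
    "('s::finite \<Rightarrow> 'a::finite \<Rightarrow> real) \<Rightarrow> real set" where
  "centered_reward_norms r = {infnorm (centering *v policy_reward r \<pi>) | \<pi>. \<pi> \<in> policies}"

end

theory Submission
  imports Defs
begin

text \<open>
  Let \<open>M = I - \<Phi>P\<close> for an irreducible stochastic matrix \<open>P\<close>. The maximum principle shows that \<open>M\<close> is
  invertible. For every \<open>x\<close> the vector \<open>h = M\<^sup>-\<^sup>1\<Phi>x\<close> solves the Poisson equation
  \<open>x = h - Ph + (d \<bullet> x)1\<close>, where \<open>d\<close> is the stationary distribution. Pairing it with the stationary
  distribution \<open>d'\<close> of another chain \<open>P'\<close> gives the exact formula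
  \<open>d' \<bullet> x - d \<bullet> x = d' \<bullet> (P' - P)h\<close>, and there is a similar one for differences of \<open>h\<close>.

  Along a segment of policies with direction \<open>u\<close>, these formulas write the increments of \<open>\<rho>\<close> and of its
  derivative as the increment of the parameter times a continuous function. So both derivatives exist,
  and \<open>\<rho>'' = 2 d \<bullet> P\<^sub>u M\<^sup>-\<^sup>1\<Phi>(P\<^sub>u v + r\<^sub>u)\<close> with \<open>v = M\<^sup>-\<^sup>1\<Phi>r\<close> and \<open>P\<^sub>u\<close>, \<open>r\<^sub>u\<close> the derivatives of the
  kernel and the reward. As \<open>\<Phi>\<close> has norm at most \<open>2\<close>, this is bounded by
  \<open>4 C\<^sub>p C\<^sub>m (C\<^sub>p C\<^sub>m \<kappa>\<^sub>r + C\<^sub>r)\<close> times the square of the norm of \<open>u\<close>, which is at most the claimed bound.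
\<close>

section \<open>Irreducible stochastic matrices\<close>

definition stochastic :: "real^'n^'n \<Rightarrow> bool" where
  "stochastic Q \<longleftrightarrow> (\<forall>i j. 0 \<le> Q $ i $ j) \<and> Q *v 1 = 1"

lemma stochastic_row_sum: "stochastic Q \<Longrightarrow> (\<Sum>j\<in>UNIV. Q $ i $ j) = 1"
  by (auto simp: stochastic_def matrix_vector_mult_def vec_eq_iff)

lemma stochastic_mat_1: "stochastic (mat 1)"
  unfolding stochastic_def by (simp add: matrix_vector_mul_lid) (simp add: mat_def)

lemma stochastic_mult:
  assumes "stochastic A" "stochastic B"
  shows "stochastic (A ** B)"
  unfolding stochastic_def
proof (intro conjI allI)
  show "0 \<le> (A ** B) $ i $ j" for i j
    using assms by (auto simp: stochastic_def matrix_matrix_mult_def intro!: sum_nonneg)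
  show "(A ** B) *v 1 = 1"
    using assms by (simp add: stochastic_def flip: matrix_vector_mul_assoc)
qed

lemma stochastic_mat_power: "stochastic Q \<Longrightarrow> stochastic (mat_power Q k)"
  by (induction k) (auto intro: stochastic_mat_1 stochastic_mult)

lemma inner_vec_1: "x \<bullet> (1::real^'n) = (\<Sum>i\<in>UNIV. x $ i)"
  by (simp add: inner_vec_def)

lemma mat_power_fixpoint: "Q *v v = v \<Longrightarrow> mat_power Q k *v v = v"
  by (induction k) (simp_all flip: matrix_vector_mul_assoc)

lemma stochastic_mult_le:
  assumes "stochastic Q" "\<And>j. v $ j \<le> c"
  shows "(Q *v v) $ i \<le> c"
proof -
  have "(Q *v v) $ i \<le> (\<Sum>j\<in>UNIV. Q $ i $ j * c)"
    unfolding matrix_vector_mult_def using assms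
    by (auto simp: stochastic_def intro!: sum_mono mult_left_mono)
  also have "\<dots> = c"
    using stochastic_row_sum[OF assms(1)] by (simp flip: sum_distrib_right)
  finally show ?thesis .
qed

lemma obtain_max_component:
  fixes v :: "real^'n"
  obtains i where "\<And>j. v $ j \<le> v $ i"
proof -
  have "finite (range (\<lambda>i. v $ i))" "range (\<lambda>i. v $ i) \<noteq> {}" by auto
  then have "Max (range (\<lambda>i. v $ i)) \<in> range (\<lambda>i. v $ i)" by (rule Max_in)
  then show ?thesis using that by (metis Max_ge \<open>finite (range (\<lambda>i. v $ i))\<close> rangeE rangeI)
qed

text \<open>Maximum principle: at a maximal component \<open>i\<close>, row \<open>i\<close> of
  \<open>mat_power Q k\<close> averages \<open>v\<close> to the maximum itself, so every
  \<open>j\<close> of positive weight attains it. Irreducibility provides a suitable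
  \<open>k\<close> for each \<open>j\<close>.\<close>

lemma irreducible_fixpoint_const:
  assumes Q: "stochastic Q" "irreducible_chain Q" and v: "Q *v v = v"
  obtains c where "v = c *\<^sub>R 1"
proof -
  obtain i where i: "\<And>j. v $ j \<le> v $ i" by (rule obtain_max_component[of v]) blast
  have "v $ j = v $ i" for j
  proof -
    obtain k where k: "mat_power Q k $ i $ j > 0"
      using Q(2) by (auto simp: irreducible_chain_def)
    let ?A = "mat_power Q k"
    have A: "stochastic ?A" using Q(1) by (rule stochastic_mat_power)
    have "(\<Sum>l\<in>UNIV. ?A $ i $ l * (v $ i - v $ l)) = v $ i - (?A *v v) $ i"
      using stochastic_row_sum[OF A]
      by (simp add: matrix_vector_mult_def right_diff_distrib sum_subtractf flip: sum_distrib_right)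
    also have "\<dots> = 0" by (simp add: mat_power_fixpoint[OF v])
    finally have "?A $ i $ j * (v $ i - v $ j) = 0"
      using A i by (subst (asm) sum_nonneg_eq_0_iff) (auto simp: stochastic_def)
    then show ?thesis using k by simp
  qed
  then show ?thesis using that[of "v $ i"] by (simp add: vec_eq_iff)
qed

section \<open>The matrix I - \<Phi>Q and its invertibility\<close>

lemma centering_mult:
  "centering *v x = x - ((x \<bullet> 1) / real CARD('n)) *\<^sub>R (1::real^'n)"
proof -
  have "(\<chi> i j. 1 / real CARD('n)) *v x = ((x \<bullet> 1) / real CARD('n)) *\<^sub>R (1::real^'n)"
    by (simp add: vec_eq_iff matrix_vector_mult_def inner_vec_1 sum_divide_distrib)
  then show ?thesis
    by (simp add: centering_def matrix_vector_mult_diff_rdistrib)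
qed

lemma resolvent_mult:
  fixes Q :: "real^'n^'n"
  shows "(mat 1 - centering ** Q) *v x = x - Q *v x + (((Q *v x) \<bullet> 1) / real CARD('n)) *\<^sub>R 1"
  by (simp add: matrix_vector_mult_diff_rdistrib centering_mult flip: matrix_vector_mul_assoc)

text \<open>A kernel vector satisfies Qv = v + c1. A maximal component of \<open>v\<close> gives c
  \<le> 0, a minimal one c \<ge> 0. So \<open>v\<close> is constant, and c = 0 also says that its
  components sum to 0.\<close>

lemma invertible_resolvent:
  fixes Q :: "real^'n^'n"
  assumes Q: "stochastic Q" "irreducible_chain Q"
  shows "invertible (mat 1 - centering ** Q)"
proof -
  have "v = 0" if v: "(mat 1 - centering ** Q) *v v = 0" for v
  proof -
    define c where "c = ((Q *v v) \<bullet> 1) / real CARD('n)"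
    have Qv: "Q *v v = v + c *\<^sub>R 1"
      using v unfolding resolvent_mult c_def by (simp add: algebra_simps)
    obtain i where "\<And>j. v $ j \<le> v $ i" by (rule obtain_max_component[of v]) blast
    then have "(Q *v v) $ i \<le> v $ i" using Q(1) by (intro stochastic_mult_le)
    moreover obtain l where "\<And>j. (- v) $ j \<le> (- v) $ l" by (rule obtain_max_component[of "- v"]) blast
    then have "(Q *v (- v)) $ l \<le> (- v) $ l" using Q(1) by (intro stochastic_mult_le)
    then have "v $ l \<le> (Q *v v) $ l"
      using matrix_vector_mult_diff_distrib[of Q 0 v] by simp
    ultimately have "c = 0" by (simp add: Qv)
    then have "Q *v v = v" by (simp add: Qv)
    then obtain k where k: "v = k *\<^sub>R 1" by (rule irreducible_fixpoint_const[OF Q])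
    have "v \<bullet> 1 = 0" using \<open>c = 0\<close> \<open>Q *v v = v\<close> by (simp add: c_def)
    then show "v = 0" by (simp add: k inner_vec_1)
  qed
  then show ?thesis
    by (simp add: invertible_left_inverse matrix_left_invertible_ker)
qed

section \<open>The stationary distribution as the solution of a linear system\<close>

lemma matrix_inv_right: "invertible A \<Longrightarrow> (A::real^'n^'n) ** matrix_inv A = mat 1"
  and matrix_inv_left: "invertible A \<Longrightarrow> matrix_inv A ** (A::real^'n^'n) = mat 1"
  unfolding invertible_def matrix_inv_def by (rule someI2_ex; blast)+

text \<open>The right-hand side of that system: a row vector \<open>d\<close> with
  \<open>d v* Q = d\<close> and component sum 1 satisfies
  \<open>d v* (mat 1 - centering ** Q) = mean_row Q\<close>.\<close>

definition mean_row :: "real^'n^'n \<Rightarrow> real^'n" where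
  "mean_row Q = (1 / real CARD('n)) *\<^sub>R (1 v* Q)"

lemma vector_mult_resolvent:
  fixes Q :: "real^'n^'n"
  shows "d v* (mat 1 - centering ** Q) = d - d v* Q + (d \<bullet> 1) *\<^sub>R mean_row Q"
proof -
  have "d v* centering = d - ((d \<bullet> 1) / real CARD('n)) *\<^sub>R 1"
    by (rule vector_eq_rdot[THEN iffD1])
      (simp add: dot_lmul_matrix centering_mult inner_diff_right inner_diff_left
        inner_commute[of 1] mult.commute)
  then show ?thesis
    by (simp add: vector_matrix_mult_diff_rdistrib vector_matrix_mult_diff_distrib mean_row_def
        scaleR_vector_matrix_assoc flip: vector_matrix_mul_assoc)
qed

text \<open>Every stationary distribution solves the system with the invertible matrix
  \<open>?M\<close>, hence uniqueness. Conversely, its solution sums to 1 and is then fixed by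
  \<open>Q\<close>; nonnegativity is the harder part.\<close>

lemma
  fixes Q :: "real^'n^'n"
  assumes Q: "stochastic Q" "irreducible_chain Q"
  defines "d \<equiv> mean_row Q v* matrix_inv (mat 1 - centering ** Q)"
  shows stationary_exists: "is_stationary Q d"
    and stationary_unique: "is_stationary Q e \<Longrightarrow> e = d"
proof -
  let ?M = "mat 1 - centering ** Q"
  note inv = invertible_resolvent[OF Q]
  have Q1: "Q *v 1 = 1" using Q(1) by (simp add: stochastic_def)
  have dM: "d v* ?M = mean_row Q"
    by (simp add: d_def vector_matrix_mul_assoc matrix_inv_left[OF inv])
  have uniq: "e = d" if "e v* ?M = mean_row Q" for e
  proof -
    have "e v* ?M v* matrix_inv ?M = e"
      by (simp only: vector_matrix_mul_assoc matrix_inv_right[OF inv] vector_matrix_mul_rid)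
    then show ?thesis by (simp add: that d_def)
  qed
  \<comment> \<open>\<open>?M\<close> fixes the all-ones vector, so pairing \<open>dM\<close> with
    it yields the normalization of \<open>d\<close>.\<close>
  have "d \<bullet> 1 = d \<bullet> (?M *v 1)"
    by (simp add: resolvent_mult Q1 inner_vec_1)
  also have "\<dots> = mean_row Q \<bullet> 1" by (simp add: dM flip: dot_lmul_matrix)
  also have "\<dots> = 1" by (simp add: mean_row_def dot_lmul_matrix Q1) (simp add: inner_vec_1)
  finally have d1: "d \<bullet> 1 = 1" .
  have dQ: "d v* Q = d" using dM by (simp add: vector_mult_resolvent d1)
  \<comment> \<open>\<open>\<bar>d\<bar> \<le> \<bar>d\<bar> Q\<close> holds componentwise and both sides have the same sum, so the normalization of
    \<open>\<bar>d\<bar>\<close> is stationary as well and agrees with \<open>d\<close> by uniqueness.\<close>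
  define a where "a = (\<chi> i. \<bar>d $ i\<bar>)"
  have le: "a $ j \<le> (a v* Q) $ j" for j
  proof -
    have "\<bar>d $ j\<bar> = \<bar>\<Sum>i\<in>UNIV. d $ i * Q $ i $ j\<bar>"
      by (subst dQ[symmetric]) (simp add: vector_matrix_mult_def)
    also have "\<dots> \<le> (\<Sum>i\<in>UNIV. \<bar>d $ i * Q $ i $ j\<bar>)" by (rule sum_abs)
    also have "\<dots> = (a v* Q) $ j"
      using Q(1) by (simp add: vector_matrix_mult_def a_def abs_mult stochastic_def)
    finally show ?thesis by (simp add: a_def)
  qed
  have "(\<Sum>j\<in>UNIV. (a v* Q) $ j - a $ j) = (a v* Q) \<bullet> 1 - a \<bullet> 1"
    by (simp add: inner_vec_1 sum_subtractf)
  also have "\<dots> = 0" by (simp add: dot_lmul_matrix Q1)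
  finally have aQ: "a v* Q = a"
    using le by (subst (asm) sum_nonneg_eq_0_iff) (auto simp: vec_eq_iff)
  have "1 \<le> a \<bullet> 1"
    using d1 by (simp add: inner_vec_1 a_def) (metis abs_ge_self sum_mono)
  then have "(1 / (a \<bullet> 1)) *\<^sub>R a = d"
    by (intro uniq) (simp add: vector_mult_resolvent aQ scaleR_vector_matrix_assoc)
  moreover have "0 \<le> ((1 / (a \<bullet> 1)) *\<^sub>R a) $ s" for s
    using \<open>1 \<le> a \<bullet> 1\<close> by (simp add: a_def)
  ultimately show "is_stationary Q d"
    using d1 dQ by (simp add: is_stationary_def inner_vec_1)
  show "e = d" if "is_stationary Q e"
    using that by (intro uniq) (simp add: is_stationary_def vector_mult_resolvent inner_vec_1)
qed

text \<open>The closed form serves to show that the stationary distribution depends continuously on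
  the policy.\<close>

lemma stationary_distribution:
  fixes Q :: "real^'n^'n"
  assumes "stochastic Q" "irreducible_chain Q"
  shows "is_stationary Q (stationary_distribution Q)"
    and "stationary_distribution Q = mean_row Q v* matrix_inv (mat 1 - centering ** Q)"
proof -
  show "stationary_distribution Q = mean_row Q v* matrix_inv (mat 1 - centering ** Q)"
    unfolding stationary_distribution_def using stationary_exists[OF assms] stationary_unique[OF assms] by blast
  then show "is_stationary Q (stationary_distribution Q)"
    using stationary_exists[OF assms] by simp
qed

section \<open>Operator norm and matrix inverse: continuity\<close>

lemma infnorm_le:
  fixes x :: "real^'n"
  assumes "\<And>i. \<bar>x $ i\<bar> \<le> b"
  shows "infnorm x \<le> b"
  unfolding infnorm_cart using assms by (intro cSup_least) auto

text \<open>Cruder than the largest row sum, but enough to bound the supremum in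
  \<open>opnorm_inf\<close> and to prove that this norm is continuous.\<close>

lemma infnorm_mult_le_sum:
  "infnorm (A *v x) \<le> (\<Sum>i\<in>UNIV. \<Sum>j\<in>UNIV. \<bar>A $ i $ j\<bar>) * infnorm (x :: real^'n)"
proof (rule infnorm_le)
  fix i
  have "\<bar>(A *v x) $ i\<bar> \<le> (\<Sum>j\<in>UNIV. \<bar>A $ i $ j * x $ j\<bar>)"
    by (simp add: matrix_vector_mult_def)
  also have "\<dots> \<le> (\<Sum>j\<in>UNIV. \<bar>A $ i $ j\<bar> * infnorm x)"
    by (auto simp: abs_mult intro!: sum_mono mult_left_mono component_le_infnorm_cart)
  also have "\<dots> = (\<Sum>j\<in>UNIV. \<bar>A $ i $ j\<bar>) * infnorm x" by (simp add: sum_distrib_right)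
  also have "\<dots> \<le> (\<Sum>i\<in>UNIV. \<Sum>j\<in>UNIV. \<bar>A $ i $ j\<bar>) * infnorm x"
    by (intro mult_right_mono infnorm_pos_le member_le_sum) (auto intro: sum_nonneg)
  finally show "\<bar>(A *v x) $ i\<bar> \<le> (\<Sum>i\<in>UNIV. \<Sum>j\<in>UNIV. \<bar>A $ i $ j\<bar>) * infnorm x" .
qed

lemma opnorm_inf_le:
  assumes "0 \<le> c" "\<And>x. infnorm (A *v x) \<le> c * infnorm x"
  shows "opnorm_inf A \<le> c"
  unfolding opnorm_inf_def
proof (rule cSUP_least)
  show "infnorm (A *v x) / infnorm x \<le> c" for x
    using assms by (cases "x = 0") (simp_all add: infnorm_0 divide_le_eq infnorm_pos_lt)
qed simp

lemma opnorm_inf_upper: "infnorm (A *v x) / infnorm x \<le> opnorm_inf A"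
  unfolding opnorm_inf_def
proof (rule cSUP_upper)
  show "bdd_above (range (\<lambda>x. infnorm (A *v x) / infnorm x))"
  proof (rule bdd_aboveI2)
    fix x :: "real^'a"
    show "infnorm (A *v x) / infnorm x \<le> (\<Sum>i\<in>UNIV. \<Sum>j\<in>UNIV. \<bar>A $ i $ j\<bar>)"
      using infnorm_mult_le_sum[of A x]
      by (cases "x = 0") (simp_all add: infnorm_0 sum_nonneg divide_le_eq infnorm_pos_lt)
  qed
qed simp

text \<open>The quotient at \<open>x = 0\<close> is 0 / 0 = 0, and the supremum is at least
  that.\<close>

lemma opnorm_inf_nonneg: "0 \<le> opnorm_inf A"
  using opnorm_inf_upper[of A 0] by (simp add: infnorm_0)

lemma infnorm_mult_le: "infnorm (A *v x) \<le> opnorm_inf A * infnorm x"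
  using opnorm_inf_upper[of A x]
  by (cases "x = 0") (simp_all add: infnorm_0 divide_le_eq infnorm_pos_lt)

lemma opnorm_inf_triangle: "opnorm_inf (A + B) \<le> opnorm_inf A + opnorm_inf B"
proof (rule opnorm_inf_le)
  fix x
  have "infnorm ((A + B) *v x) \<le> infnorm (A *v x) + infnorm (B *v x)"
    by (simp add: matrix_vector_mult_add_rdistrib infnorm_triangle)
  also have "\<dots> \<le> (opnorm_inf A + opnorm_inf B) * infnorm x"
    using infnorm_mult_le[of A x] infnorm_mult_le[of B x] by (simp add: distrib_right)
  finally show "infnorm ((A + B) *v x) \<le> (opnorm_inf A + opnorm_inf B) * infnorm x" .
qed (simp add: opnorm_inf_nonneg)

lemma opnorm_inf_scaleR: "opnorm_inf (c *\<^sub>R A) = \<bar>c\<bar> * opnorm_inf A"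
proof -
  have le: "opnorm_inf (c *\<^sub>R A) \<le> \<bar>c\<bar> * opnorm_inf A" for c :: real and A :: "real^'a^'a"
  proof (rule opnorm_inf_le)
    show "infnorm (c *\<^sub>R A *v x) \<le> \<bar>c\<bar> * opnorm_inf A * infnorm x" for x
      using infnorm_mult_le[of A x]
      by (simp add: scaleR_matrix_vector_assoc[symmetric] infnorm_mul mult.assoc mult_left_mono)
  qed (simp add: opnorm_inf_nonneg)
  show ?thesis
  proof (cases "c = 0")
    case True
    then show ?thesis using le[of 0 A] opnorm_inf_nonneg[of "0 *\<^sub>R A"] by simp
  next
    case False
    \<comment> \<open>The reverse inequality is the first one for the scalar \<open>1 / c\<close>
      and the matrix \<open>c *\<^sub>R A\<close>.\<close>
    then have "\<bar>c\<bar> * opnorm_inf A \<le> opnorm_inf (c *\<^sub>R A)"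
      using le[of "1 / c" "c *\<^sub>R A"] by (simp add: field_simps)
    with le[of c A] show ?thesis by simp
  qed
qed

lemma opnorm_inf_le_sum: "opnorm_inf A \<le> (\<Sum>i\<in>UNIV. \<Sum>j\<in>UNIV. \<bar>A $ i $ j\<bar>)"
  by (intro opnorm_inf_le infnorm_mult_le_sum sum_nonneg) auto

lemma abs_diff_opnorm_inf_le: "\<bar>opnorm_inf A - opnorm_inf B\<bar> \<le> opnorm_inf (A - B)"
proof -
  have "opnorm_inf (B - A) = opnorm_inf (A - B)"
    using opnorm_inf_scaleR[of "- 1" "A - B"] by simp
  then show ?thesis
    using opnorm_inf_triangle[of "A - B" B] opnorm_inf_triangle[of "B - A" A] by simp
qed

text \<open>By the reverse triangle inequality the norm changes by at most the sum of the absolute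
  entry differences, which tends to 0.\<close>

lemma continuous_on_opnorm_inf:
  fixes A :: "'x::topological_space \<Rightarrow> real^'n^'n"
  assumes "continuous_on S A"
  shows "continuous_on S (\<lambda>x. opnorm_inf (A x))"
  unfolding continuous_on_def
proof
  fix a assume "a \<in> S"
  let ?s = "\<lambda>x. \<Sum>i\<in>UNIV. \<Sum>j\<in>UNIV. \<bar>(A x - A a) $ i $ j\<bar>"
  have "continuous_on S ?s" by (intro continuous_intros assms)
  then have "(?s \<longlongrightarrow> ?s a) (at a within S)"
    using \<open>a \<in> S\<close> unfolding continuous_on_def by (rule bspec)
  then have "(?s \<longlongrightarrow> 0) (at a within S)" by simp
  moreover have "\<forall>\<^sub>F x in at a within S. norm (opnorm_inf (A x) - opnorm_inf (A a)) \<le> ?s x"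
    unfolding real_norm_def
    by (rule always_eventually, rule allI, rule order_trans[OF abs_diff_opnorm_inf_le opnorm_inf_le_sum])
  ultimately show "((\<lambda>x. opnorm_inf (A x)) \<longlongrightarrow> opnorm_inf (A a)) (at a within S)"
    by (rule LIM_zero_cancel[OF Lim_null_comparison, rotated])
qed

section \<open>Continuity of products, determinants and inverses\<close>

lemma continuous_on_matrix_mult:
  fixes A :: "'x::topological_space \<Rightarrow> real^'n^'m"
  assumes "continuous_on S A" "continuous_on S B"
  shows "continuous_on S (\<lambda>x. A x ** B x)"
  unfolding matrix_matrix_mult_def by (intro continuous_intros assms)

lemma continuous_on_matrix_vector_mult:
  fixes A :: "'x::topological_space \<Rightarrow> real^'n^'m"
  assumes "continuous_on S A" "continuous_on S v"
  shows "continuous_on S (\<lambda>x. A x *v v x)"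
  unfolding matrix_vector_mult_def by (intro continuous_intros assms)

lemma continuous_on_vector_matrix_mult:
  fixes A :: "'x::topological_space \<Rightarrow> real^'n^'m"
  assumes "continuous_on S A" "continuous_on S v"
  shows "continuous_on S (\<lambda>x. v x v* A x)"
  unfolding vector_matrix_mult_def by (intro continuous_intros assms)

lemma continuous_on_det:
  fixes A :: "'x::topological_space \<Rightarrow> real^'n^'n"
  assumes "continuous_on S A"
  shows "continuous_on S (\<lambda>x. det (A x))"
  unfolding det_def by (intro continuous_intros assms)

text \<open>Cramer's rule: each entry of the inverse is a quotient of determinants with nonzero
  denominator. In \<open>?C x l k\<close> the unit vector \<open>axis l 1\<close> replaces column
  \<open>k\<close>.\<close>

lemma continuous_on_matrix_inv:
  fixes A :: "'x::topological_space \<Rightarrow> real^'n^'n"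
  assumes A: "continuous_on S A" and inv: "\<And>x. x \<in> S \<Longrightarrow> invertible (A x)"
  shows "continuous_on S (\<lambda>x. matrix_inv (A x))"
proof -
  let ?C = "\<lambda>x l k. \<chi> i j. if j = k then axis l 1 $ i else A x $ i $ j"
  have "matrix_inv (A x) $ k $ l = det (?C x l k) / det (A x)" if "x \<in> S" for x k l
  proof -
    have "A x *v (matrix_inv (A x) *v axis l 1) = axis l 1"
      by (simp add: matrix_vector_mul_assoc matrix_inv_right inv that)
    then have "matrix_inv (A x) *v axis l 1 = (\<chi> k. det (?C x l k) / det (A x))"
      using inv[OF that] by (simp add: cramer invertible_det_nz)
    then show ?thesis
      by (simp add: vec_eq_iff matrix_vector_mult_basis column_def)
  qed
  then have eq: "matrix_inv (A x) = (\<chi> k l. det (?C x l k) / det (A x))" if "x \<in> S" for x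
    using that by (simp add: vec_eq_iff)
  have C: "continuous_on S (\<lambda>x. ?C x l k)" for l k
  proof (intro continuous_intros)
    show "continuous_on S (\<lambda>x. if j = k then axis l 1 $ i else A x $ i $ j)" for i j
      by (cases "j = k") (auto intro!: continuous_intros A)
  qed
  have "continuous_on S (\<lambda>x. (\<chi> k l. det (?C x l k) / det (A x)) :: real^'n^'n)"
    using inv by (intro continuous_intros continuous_on_det A C) (auto simp: invertible_det_nz)
  then show ?thesis by (rule continuous_on_eq) (simp add: eq)
qed

section \<open>The Poisson equation\<close>

lemma stationary_abs_le:
  assumes "is_stationary Q d"
  shows "\<bar>d \<bullet> x\<bar> \<le> infnorm x"
proof -
  have "\<bar>d \<bullet> x\<bar> \<le> (\<Sum>i\<in>UNIV. \<bar>d $ i * x $ i\<bar>)" by (simp add: inner_vec_def)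
  also have "\<dots> \<le> (\<Sum>i\<in>UNIV. d $ i * infnorm x)"
    using assms
    by (auto simp: abs_mult is_stationary_def intro!: sum_mono mult_left_mono component_le_infnorm_cart)
  also have "\<dots> = infnorm x"
    using assms by (simp add: is_stationary_def flip: sum_distrib_right)
  finally show ?thesis .
qed

text \<open>Centering subtracts the mean of the components, itself at most \<open>infnorm x\<close>
  in absolute value; hence the factor 2.\<close>

lemma infnorm_centering_le: "infnorm (centering *v x) \<le> 2 * infnorm (x::real^'n)"
proof (rule infnorm_le)
  fix i
  have "\<bar>x \<bullet> 1\<bar> \<le> (\<Sum>j\<in>UNIV. \<bar>x $ j\<bar>)" by (simp add: inner_vec_1)
  also have "\<dots> \<le> (\<Sum>j\<in>(UNIV::'n set). infnorm x)"
    by (intro sum_mono component_le_infnorm_cart)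
  finally have "\<bar>(x \<bullet> 1) / real CARD('n)\<bar> \<le> infnorm x"
    by (simp add: divide_le_eq mult.commute)
  then show "\<bar>(centering *v x) $ i\<bar> \<le> 2 * infnorm x"
    using component_le_infnorm_cart[of x i] abs_triangle_ineq4[of "x $ i" "(x \<bullet> 1) / real CARD('n)"]
    by (simp add: centering_mult)
qed

text \<open>For an irreducible stochastic \<open>Q\<close>, the relative value function of the chain
  with reward \<open>x\<close>, normalized so that its components sum to 0.\<close>

definition bias :: "real^'n^'n \<Rightarrow> real^'n \<Rightarrow> real^'n" where
  "bias Q x = matrix_inv (mat 1 - centering ** Q) *v (centering *v x)"

lemma bias_scaleR: "bias Q (c *\<^sub>R x) = c *\<^sub>R bias Q x"
  by (simp add: bias_def matrix_vector_mult_scaleR)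

locale ergodic_chain =
  fixes Q :: "real^'n^'n"
  assumes stochastic: "stochastic Q" and irreducible: "irreducible_chain Q"
begin

abbreviation "d \<equiv> stationary_distribution Q"

lemmas invertible = invertible_resolvent[OF stochastic irreducible]
lemmas stationary = stationary_distribution(1)[OF stochastic irreducible]

lemma resolvent_bias: "(mat 1 - centering ** Q) *v bias Q x = centering *v x"
  unfolding bias_def
  by (subst matrix_vector_mul_assoc) (simp add: matrix_inv_right[OF invertible])

lemma bias_unique: "(mat 1 - centering ** Q) *v h = centering *v x \<Longrightarrow> h = bias Q x"
  unfolding bias_def
  by (drule sym) (simp add: matrix_vector_mul_assoc matrix_inv_left[OF invertible])

lemma stationary_fixed: "d v* Q = d"
  using stationary by (simp add: is_stationary_def)

text \<open>Both centering and the resolvent differ from x and I - Q by multiples of the all-ones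
  vector only, so the equation holds up to such a multiple. Pairing with \<open>d\<close>
  annihilates h - Qh and identifies the coefficient.\<close>

lemma poisson_equation: "x = bias Q x - Q *v bias Q x + (d \<bullet> x) *\<^sub>R 1"
proof -
  obtain c where x: "x = bias Q x - Q *v bias Q x + c *\<^sub>R 1"
  proof
    show "x = bias Q x - Q *v bias Q x
        + ((Q *v bias Q x) \<bullet> 1 / real CARD('n) + (x \<bullet> 1) / real CARD('n)) *\<^sub>R 1"
      using resolvent_bias[of x, unfolded resolvent_mult centering_mult, symmetric]
      by (simp only: scaleR_add_left diff_eq_eq add.assoc)
  qed
  have "d \<bullet> x = d \<bullet> (bias Q x - Q *v bias Q x + c *\<^sub>R 1)"
    using x by (rule arg_cong)
  also have "\<dots> = c"
    using stationary
    by (simp add: inner_add_right inner_diff_right stationary_fixed inner_vec_1 is_stationary_def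
        flip: dot_lmul_matrix)
  finally show ?thesis using x by (rule ssubst)
qed

end

text \<open>Stationarity for \<open>Q'\<close> lets \<open>bias Q x\<close> be replaced by
  \<open>Q' *v bias Q x\<close> in the paired Poisson equation of \<open>Q\<close>. There is no
  remainder term, because the right-hand side keeps the new distribution.\<close>

lemma stationary_difference:
  assumes "ergodic_chain Q" "ergodic_chain Q'"
  shows "stationary_distribution Q' \<bullet> x - stationary_distribution Q \<bullet> x
    = stationary_distribution Q' \<bullet> ((Q' - Q) *v bias Q x)"
proof -
  interpret Q: ergodic_chain Q by fact
  interpret Q': ergodic_chain Q' by fact
  have "Q'.d \<bullet> x = Q'.d \<bullet> (bias Q x - Q *v bias Q x + (Q.d \<bullet> x) *\<^sub>R 1)"
    by (rule arg_cong[OF Q.poisson_equation])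
  also have "\<dots> = Q'.d \<bullet> (Q' *v bias Q x) - Q'.d \<bullet> (Q *v bias Q x) + Q.d \<bullet> x"
    using Q'.stationary
    by (simp add: inner_add_right inner_diff_right Q'.stationary_fixed inner_vec_1
        is_stationary_def flip: dot_lmul_matrix[of _ Q'])
  finally show ?thesis
    by (simp add: matrix_vector_mult_diff_rdistrib inner_diff_right)
qed

text \<open>A resolvent identity: \<open>centering ** (Q' - Q)\<close> is the difference of the two
  matrices I - \<Phi>Q and I - \<Phi>Q'.\<close>

lemma bias_difference:
  assumes "ergodic_chain Q" "ergodic_chain Q'"
  shows "bias Q' x' - bias Q x = bias Q ((Q' - Q) *v bias Q' x' + (x' - x))"
proof (rule ergodic_chain.bias_unique[OF assms(1)])
  have "centering *v ((Q' - Q) *v bias Q' x') =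
      (mat 1 - centering ** Q) *v bias Q' x' - (mat 1 - centering ** Q') *v bias Q' x'"
    by (simp add: matrix_vector_mult_diff_rdistrib matrix_vector_mult_diff_distrib
        flip: matrix_vector_mul_assoc)
  then show "(mat 1 - centering ** Q) *v (bias Q' x' - bias Q x)
      = centering *v ((Q' - Q) *v bias Q' x' + (x' - x))"
    unfolding matrix_vector_mult_diff_distrib matrix_vector_right_distrib
      ergodic_chain.resolvent_bias[OF assms(1)] ergodic_chain.resolvent_bias[OF assms(2)]
    by simp
qed

text \<open>Caratheodory's characterization of the derivative; relative to \<open>S\<close> it also
  covers the endpoints of an interval.\<close>

lemma has_vector_derivative_factor:
  fixes f :: "real \<Rightarrow> real"
  assumes "\<And>a. a \<in> S \<Longrightarrow> f a - f b = (a - b) * g a" "continuous_on S g" "b \<in> S"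
  shows "(f has_vector_derivative g b) (at b within S)"
proof -
  have "((\<lambda>a. f b + g a * (a - b)) has_field_derivative g b) (at b within S)"
    unfolding DERIV_caratheodory_within
    using assms(2,3) by (intro exI[of _ g]) (auto simp: continuous_on_eq_continuous_within)
  then show ?thesis
    unfolding has_real_derivative_iff_has_vector_derivative
    by (rule has_vector_derivative_transform[OF assms(3), rotated])
      (use assms(1) in \<open>auto simp: algebra_simps\<close>)
qed

section \<open>Policies\<close>

text \<open>The empty case matters: with a single action \<open>tangent_sphere\<close> is empty and
  the maximum is 0 by convention.\<close>

lemma compact_image_is_max:
  fixes f :: "'x::topological_space \<Rightarrow> real"
  assumes "compact S" "continuous_on S f"
  obtains m where "is_max (f ` S) m"
proof (cases "S = {}")
  case False
  then obtain x where "x \<in> S" "\<And>y. y \<in> S \<Longrightarrow> f y \<le> f x"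
    using continuous_attains_sup[OF assms(1) False assms(2)] by blast
  then have "is_max (f ` S) (f x)" by (auto simp: is_max_def)
  then show thesis by (rule that)
qed (auto simp: is_max_def intro: that[of 0])

lemma convex_policies: "convex policies"
  by (rule convexI)
    (auto simp: policies_def sum.distrib simp flip: sum_distrib_left)

lemma policy_le_1:
  assumes "\<pi> \<in> policies"
  shows "\<pi> $ p \<le> 1"
proof -
  obtain s a where p: "p = (s, a)" by fastforce
  have "\<pi> $ (s, a) \<le> (\<Sum>a\<in>UNIV. \<pi> $ (s, a))"
    using assms by (intro member_le_sum) (auto simp: policies_def)
  then show ?thesis using assms by (simp add: p policies_def)
qed

lemma compact_policies: "compact (policies :: (real^('s::finite \<times> 'a::finite)) set)"
proof -
  let ?P = "policies :: (real^('s \<times> 'a)) set"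
  have "norm \<pi> \<le> (\<Sum>p\<in>(UNIV :: ('s \<times> 'a) set). 1)" if "\<pi> \<in> ?P" for \<pi>
  proof (rule order_trans[OF norm_le_l1_cart sum_mono])
    fix p :: "'s \<times> 'a"
    show "\<bar>\<pi> $ p\<bar> \<le> 1"
      using policy_le_1[OF that, of p] that by (cases p) (simp add: policies_def)
  qed
  then have "bounded ?P" by (intro boundedI) auto
  moreover have "closed ?P"
    unfolding policies_def
    by (intro closed_Collect_conj closed_Collect_all closed_Collect_le closed_Collect_eq
        continuous_intros)
  ultimately show ?thesis by (simp add: compact_eq_bounded_closed)
qed

definition tangent_sphere :: "(real^('s::finite \<times> 'a::finite)) set" where
  "tangent_sphere = {u. (\<forall>s. (\<Sum>a\<in>UNIV. u $ (s, a)) = 0) \<and> norm u = 1}"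

lemma compact_tangent_sphere:
  "compact (tangent_sphere :: (real^('s::finite \<times> 'a::finite)) set)"
proof -
  have "bounded (tangent_sphere :: (real^('s \<times> 'a)) set)"
    by (rule boundedI[of _ 1]) (simp add: tangent_sphere_def)
  moreover have "closed (tangent_sphere :: (real^('s \<times> 'a)) set)"
    unfolding tangent_sphere_def
    by (intro closed_Collect_conj closed_Collect_all closed_Collect_eq continuous_intros)
  ultimately show ?thesis by (simp add: compact_eq_bounded_closed)
qed

text \<open>The uniform policy lies in the relative interior of the polytope of policies, so every tangent
  direction is proportional to a difference of two policies. This turns a supremum over the
  non-compact set of pairs of distinct policies into one over a sphere.\<close>

lemma policy_quotients_eq_image:
  fixes f :: "real^('s::finite \<times> 'a::finite) \<Rightarrow> real"
  assumes f: "\<And>c u. f (c *\<^sub>R u) = \<bar>c\<bar> * f u"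
  shows "{f (\<pi>' - \<pi>) / norm (\<pi>' - \<pi>) | \<pi> \<pi>'. \<pi> \<in> policies \<and> \<pi>' \<in> policies \<and> \<pi> \<noteq> \<pi>'}
    = f ` tangent_sphere" (is "?L = ?R")
proof
  show "?L \<subseteq> ?R"
  proof clarify
    fix \<pi> \<pi>' :: "real^('s \<times> 'a)"
    assume *: "\<pi> \<in> policies" "\<pi>' \<in> policies" "\<pi> \<noteq> \<pi>'"
    define u where "u = (1 / norm (\<pi>' - \<pi>)) *\<^sub>R (\<pi>' - \<pi>)"
    have "u \<in> tangent_sphere"
      using * by (simp add: tangent_sphere_def u_def policies_def sum_subtractf
          flip: sum_divide_distrib)
    moreover have "f (\<pi>' - \<pi>) / norm (\<pi>' - \<pi>) = f u" by (simp add: u_def f)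
    ultimately show "f (\<pi>' - \<pi>) / norm (\<pi>' - \<pi>) \<in> ?R" by simp
  qed
  show "?R \<subseteq> ?L"
  proof (rule image_subsetI)
    fix u :: "real^('s \<times> 'a)" assume u: "u \<in> tangent_sphere"
    define \<mu> :: "real^('s \<times> 'a)" where "\<mu> = (\<chi> p. 1 / real CARD('a))"
    \<comment> \<open>A unit vector has components at least -1, so a step of length
      \<open>1 / real CARD('a)\<close> from the uniform policy keeps all probabilities
      nonnegative.\<close>
    define \<nu> where "\<nu> = \<mu> + (1 / real CARD('a)) *\<^sub>R u"
    have "\<bar>u $ p\<bar> \<le> 1" for p
      using component_le_norm_cart[of u p] u by (simp add: tangent_sphere_def)
    then have "0 \<le> 1 + u $ p" for p by (smt (verit))
    then have "0 \<le> \<nu> $ p" for p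
      by (simp add: \<nu>_def \<mu>_def flip: add_divide_distrib)
    moreover have "(\<Sum>a\<in>UNIV. \<nu> $ (s, a)) = 1" for s
      using u by (simp add: \<nu>_def \<mu>_def tangent_sphere_def sum.distrib flip: sum_divide_distrib)
    ultimately have "\<nu> \<in> policies" by (simp add: policies_def)
    moreover have "\<mu> \<in> policies" by (simp add: policies_def \<mu>_def)
    moreover have "norm u = 1" using u by (simp add: tangent_sphere_def)
    moreover from this have "\<mu> \<noteq> \<nu>" by (auto simp: \<nu>_def)
    moreover have "f u = f (\<nu> - \<mu>) / norm (\<nu> - \<mu>)"
      using \<open>norm u = 1\<close> by (simp add: \<nu>_def f)
    ultimately show "f u \<in> ?L" by blast
  qed
qed

lemma linear_policy_kernel: "linear (policy_kernel K)"
  by (rule linearI)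
    (simp_all add: policy_kernel_def vec_eq_iff distrib_right sum.distrib sum_distrib_left mult.assoc)

lemma linear_policy_reward: "linear (policy_reward r)"
  by (rule linearI)
    (simp_all add: policy_reward_def vec_eq_iff distrib_right sum.distrib sum_distrib_left mult.assoc)

lemma continuous_on_policy_kernel: "continuous_on S (policy_kernel K)"
  by (simp add: linear_policy_kernel linear_continuous_on linear_conv_bounded_linear[symmetric])

lemma continuous_on_policy_reward: "continuous_on S (policy_reward r)"
  by (simp add: linear_policy_reward linear_continuous_on linear_conv_bounded_linear[symmetric])

lemma stochastic_policy_kernel:
  fixes K :: "'s::finite \<Rightarrow> 'a::finite \<Rightarrow> 's pmf"
  assumes "\<pi> \<in> policies"
  shows "stochastic (policy_kernel K \<pi>)"
proof -
  have "(\<Sum>s'\<in>UNIV. \<Sum>a\<in>UNIV. \<pi> $ (s, a) * pmf (K s a) s') = 1" for s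
  proof (subst sum.swap)
    have "(\<Sum>s'\<in>UNIV. pmf (K s a) s') = 1" for a by (rule sum_pmf_eq_1) auto
    then show "(\<Sum>a\<in>UNIV. \<Sum>s'\<in>UNIV. \<pi> $ (s, a) * pmf (K s a) s') = 1"
      using assms by (simp add: policies_def flip: sum_distrib_left)
  qed
  then show ?thesis
    using assms
    by (auto simp: stochastic_def policy_kernel_def policies_def matrix_vector_mult_def vec_eq_iff
        intro!: sum_nonneg)
qed

section \<open>Derivatives of the average reward along segments of policies\<close>

locale ergodic_mdp =
  fixes K :: "'s::finite \<Rightarrow> 'a::finite \<Rightarrow> 's pmf"
    and r :: "'s \<Rightarrow> 'a \<Rightarrow> real"
  assumes irreducible: "\<And>\<pi>. \<pi> \<in> policies \<Longrightarrow> irreducible_chain (policy_kernel K \<pi>)"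
begin

abbreviation "P \<equiv> policy_kernel K"
abbreviation "R \<equiv> policy_reward r"
abbreviation "d \<pi> \<equiv> stationary_distribution (P \<pi>)"

lemma ergodic: "\<pi> \<in> policies \<Longrightarrow> ergodic_chain (P \<pi>)"
  by (simp add: ergodic_chain_def irreducible stochastic_policy_kernel)

lemma continuous_on_resolvent_inv:
  "continuous_on policies (\<lambda>\<pi>. matrix_inv (mat 1 - centering ** P \<pi>))"
  by (intro continuous_on_matrix_inv continuous_on_matrix_mult continuous_intros
      continuous_on_policy_kernel ergodic_chain.invertible ergodic)

lemma continuous_on_bias:
  assumes "continuous_on policies x"
  shows "continuous_on policies (\<lambda>\<pi>. bias (P \<pi>) (x \<pi>))"
  unfolding bias_def
  by (intro continuous_on_matrix_vector_mult continuous_on_resolvent_inv continuous_intros assms)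

lemma continuous_on_stationary: "continuous_on policies d"
proof (rule continuous_on_eq)
  show "continuous_on policies
      (\<lambda>\<pi>. mean_row (P \<pi>) v* matrix_inv (mat 1 - centering ** P \<pi>))"
    unfolding mean_row_def
    by (intro continuous_on_vector_matrix_mult continuous_on_resolvent_inv continuous_intros
        continuous_on_policy_kernel)
  show "mean_row (P \<pi>) v* matrix_inv (mat 1 - centering ** P \<pi>) = d \<pi>" if "\<pi> \<in> policies" for \<pi>
    using that stationary_distribution(2)[OF stochastic_policy_kernel irreducible] by metis
qed

text \<open>\<open>d \<pi> \<bullet> advantage u \<pi>\<close> is the derivative of the average reward at \<open>\<pi>\<close> in direction \<open>u\<close>.\<close>

definition advantage :: "real^('s \<times> 'a) \<Rightarrow> real^('s \<times> 'a) \<Rightarrow> real^'s" where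
  "advantage u \<pi> = P u *v bias (P \<pi>) (R \<pi>) + R u"

lemma average_reward_inner: "average_reward K r \<pi> = d \<pi> \<bullet> R \<pi>"
  by (simp add: average_reward_def inner_vec_def)

text \<open>Kernel and reward are linear in the policy, so their increments are exactly
  \<open>c\<close> times \<open>P u\<close> and \<open>R u\<close>. Factoring out \<open>c\<close>
  prepares \<open>has_vector_derivative_factor\<close>.\<close>

lemma average_reward_difference:
  assumes "\<pi> \<in> policies" "\<pi>' \<in> policies" "\<pi>' - \<pi> = c *\<^sub>R u"
  shows "average_reward K r \<pi>' - average_reward K r \<pi> = c * (d \<pi>' \<bullet> advantage u \<pi>)"
proof -
  have P: "P \<pi>' - P \<pi> = c *\<^sub>R P u" and R: "R \<pi>' - R \<pi> = c *\<^sub>R R u"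
    using assms(3) linear_policy_kernel[of K] linear_policy_reward[of r]
    by (metis linear_diff linear_scale)+
  have "average_reward K r \<pi>' - average_reward K r \<pi>
      = (d \<pi>' \<bullet> R \<pi> - d \<pi> \<bullet> R \<pi>) + d \<pi>' \<bullet> (R \<pi>' - R \<pi>)"
    by (simp add: average_reward_inner inner_diff_right)
  also have "\<dots> = c * (d \<pi>' \<bullet> advantage u \<pi>)"
    unfolding stationary_difference[OF ergodic ergodic, OF assms(1,2)] P R advantage_def
    by (simp add: inner_add_right distrib_left flip: scaleR_matrix_vector_assoc)
  finally show ?thesis .
qed

text \<open>A discrete product rule. The change of the distribution and the change of the advantage
  contribute the same vector, paired with \<open>d \<pi>'\<close> and \<open>d \<pi>\<close>
  respectively.\<close>

lemma policy_gradient_difference: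
  assumes "\<pi> \<in> policies" "\<pi>' \<in> policies" "\<pi>' - \<pi> = c *\<^sub>R u"
  shows "d \<pi>' \<bullet> advantage u \<pi>' - d \<pi> \<bullet> advantage u \<pi>
    = c * ((d \<pi>' + d \<pi>) \<bullet> (P u *v bias (P \<pi>) (advantage u \<pi>')))"
proof -
  have P: "P \<pi>' - P \<pi> = c *\<^sub>R P u" and R: "R \<pi>' - R \<pi> = c *\<^sub>R R u"
    using assms(3) linear_policy_kernel[of K] linear_policy_reward[of r]
    by (metis linear_diff linear_scale)+
  have "advantage u \<pi>' - advantage u \<pi> = P u *v (bias (P \<pi>') (R \<pi>') - bias (P \<pi>) (R \<pi>))"
    by (simp add: advantage_def matrix_vector_mult_diff_distrib)
  \<comment> \<open>The argument of \<open>bias (P \<pi>)\<close> supplied by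
    \<open>bias_difference\<close> is \<open>c\<close> times \<open>advantage u \<pi>'\<close>
    itself.\<close>
  also have "\<dots> = c *\<^sub>R (P u *v bias (P \<pi>) (advantage u \<pi>'))"
    unfolding bias_difference[OF ergodic ergodic, OF assms(1,2)] P R advantage_def
    by (simp add: bias_scaleR matrix_vector_mult_scaleR
        flip: scaleR_matrix_vector_assoc scaleR_add_right)
  finally have g: "advantage u \<pi>' - advantage u \<pi> = c *\<^sub>R (P u *v bias (P \<pi>) (advantage u \<pi>'))" .
  have "d \<pi>' \<bullet> advantage u \<pi>' - d \<pi> \<bullet> advantage u \<pi>
      = (d \<pi>' \<bullet> advantage u \<pi>' - d \<pi> \<bullet> advantage u \<pi>') + d \<pi> \<bullet> (advantage u \<pi>' - advantage u \<pi>)"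
    by (simp add: inner_diff_right)
  also have "\<dots> = c * ((d \<pi>' + d \<pi>) \<bullet> (P u *v bias (P \<pi>) (advantage u \<pi>')))"
    unfolding stationary_difference[OF ergodic ergodic, OF assms(1,2)] P g
    by (simp add: inner_add_left distrib_left flip: scaleR_matrix_vector_assoc)
  finally show ?thesis .
qed

lemma continuous_on_advantage: "continuous_on policies (advantage u)"
  unfolding advantage_def
  by (intro continuous_on_matrix_vector_mult continuous_on_bias continuous_on_policy_reward
      continuous_intros)

lemma second_derivative:
  assumes \<pi>: "\<pi> \<in> policies" and \<pi>': "\<pi>' \<in> policies"
  defines "u \<equiv> \<pi>' - \<pi>"
  shows "has_second_dir_deriv (average_reward K r) \<pi> \<pi>'" (is ?has)
    and "second_dir_deriv (average_reward K r) \<pi> \<pi>'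
      = 2 * (d \<pi> \<bullet> (P u *v bias (P \<pi>) (advantage u \<pi>)))" (is ?eq)
proof -
  define p where "p = (\<lambda>a. (1 - a) *\<^sub>R \<pi> + a *\<^sub>R \<pi>')"
  have p: "p a \<in> policies" if "a \<in> {0..1}" for a
    using that \<pi> \<pi>' convexD[OF convex_policies, of \<pi> \<pi>' "1 - a" a] by (simp add: p_def)
  have p0: "p 0 = \<pi>" by (simp add: p_def)
  have pd: "p a - p b = (a - b) *\<^sub>R u" for a b
    by (simp add: p_def u_def algebra_simps)
  have "continuous_on {0..1} p" unfolding p_def by (intro continuous_intros)
  then have cont: "continuous_on {0..1} (\<lambda>a. f (p a))" if "continuous_on policies f"
    for f :: "_ \<Rightarrow> real"
    using continuous_on_compose2[OF that] p by blast
  let ?f = "along_segment (average_reward K r) \<pi> \<pi>'"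
  let ?f' = "\<lambda>a. d (p a) \<bullet> advantage u (p a)"
  have 1: "(?f has_vector_derivative ?f' b) (at b within {0..1})" if b: "b \<in> {0..1}" for b
  proof (rule has_vector_derivative_factor[where g = "\<lambda>a. d (p a) \<bullet> advantage u (p b)"])
    show "?f a - ?f b = (a - b) * (d (p a) \<bullet> advantage u (p b))" if "a \<in> {0..1}" for a
      using average_reward_difference[OF p p pd] that b
      by (simp add: along_segment_def p_def)
    show "continuous_on {0..1} (\<lambda>a. d (p a) \<bullet> advantage u (p b))"
      by (intro cont continuous_intros continuous_on_stationary)
  qed fact
  \<comment> \<open>Knowing \<open>segment_deriv\<close> on \<open>{0..1}\<close> suffices, since
    the outer derivative is also taken within that interval.\<close>
  then have f': "segment_deriv (average_reward K r) \<pi> \<pi>' b = ?f' b" if "b \<in> {0..1}" for b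
    unfolding segment_deriv_def using that by (intro vector_derivative_within_closed_interval) auto
  let ?g = "\<lambda>a. (d (p a) + d \<pi>) \<bullet> (P u *v bias (P \<pi>) (advantage u (p a)))"
  have "(segment_deriv (average_reward K r) \<pi> \<pi>' has_vector_derivative ?g 0) (at 0 within {0..1})"
  proof (rule has_vector_derivative_factor[where g = ?g])
    show "segment_deriv (average_reward K r) \<pi> \<pi>' a - segment_deriv (average_reward K r) \<pi> \<pi>' 0
        = (a - 0) * ?g a" if "a \<in> {0..1}" for a
      using policy_gradient_difference[OF p p pd, of 0 a] that by (simp add: f' p0)
    show "continuous_on {0..1} ?g"
      unfolding bias_def
      by (intro cont continuous_intros continuous_on_stationary continuous_on_matrix_vector_mult
          continuous_on_advantage)
  qed simp
  \<comment> \<open>At parameter 0 the two stationary distributions coincide, whence the factor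
    2.\<close>
  also have "?g 0 = 2 * (d \<pi> \<bullet> (P u *v bias (P \<pi>) (advantage u \<pi>)))"
    unfolding p0 inner_add_left by simp
  finally have 2: "(segment_deriv (average_reward K r) \<pi> \<pi>' has_vector_derivative
    2 * (d \<pi> \<bullet> (P u *v bias (P \<pi>) (advantage u \<pi>)))) (at 0 within {0..1})" .
  show ?has
    unfolding has_second_dir_deriv_def differentiable_on_def
    using 1 2 by (blast intro: differentiableI_vector)
  show ?eq
    unfolding second_dir_deriv_def
    using 2 by (intro vector_derivative_within_closed_interval) auto
qed

end

section \<open>Norm estimates and the smoothness constant\<close>

lemma bias_bound:
  assumes "opnorm_inf (matrix_inv (mat 1 - centering ** Q)) \<le> C"
  shows "infnorm (bias Q x) \<le> C * infnorm (centering *v x)"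
  unfolding bias_def
  by (intro order_trans[OF infnorm_mult_le] mult_right_mono assms infnorm_pos_le)

lemma kernel_quotients_eq: "kernel_quotients K = (\<lambda>u. opnorm_inf (policy_kernel K u)) ` tangent_sphere"
  unfolding kernel_quotients_def
  by (subst policy_quotients_eq_image[symmetric])
    (simp_all add: linear_scale[OF linear_policy_kernel] linear_diff[OF linear_policy_kernel]
      opnorm_inf_scaleR)

lemma reward_quotients_eq: "reward_quotients r = (\<lambda>u. infnorm (policy_reward r u)) ` tangent_sphere"
  unfolding reward_quotients_def
  by (subst policy_quotients_eq_image[symmetric])
    (simp_all add: linear_scale[OF linear_policy_reward] linear_diff[OF linear_policy_reward]
      infnorm_mul)

lemma is_max_upper: "is_max S m \<Longrightarrow> x \<in> S \<Longrightarrow> x \<le> m"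
  by (auto simp: is_max_def split: if_splits)

lemma is_max_nonneg: "is_max S m \<Longrightarrow> (\<And>x. x \<in> S \<Longrightarrow> 0 \<le> x) \<Longrightarrow> 0 \<le> m"
  by (auto simp: is_max_def split: if_splits)

theorem lemma4:
  fixes K :: "'s::finite \<Rightarrow> 'a::finite \<Rightarrow> 's pmf"
    and r :: "'s \<Rightarrow> 'a \<Rightarrow> real"
  assumes reward_bounded: "\<forall>s a. \<bar>r s a\<bar> \<in> {0..1}"
    and ergodic: "\<forall>\<pi>\<in>policies. irreducible_chain (policy_kernel K \<pi>) \<and>
                              aperiodic_chain (policy_kernel K \<pi>)"
  shows "(\<forall>\<pi>\<in>policies. invertible (mat 1 - centering ** policy_kernel K \<pi>)) \<and>
    (\<exists>Cm Cp Cr \<kappa>r :: real.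
       Cm \<ge> 0 \<and> Cp \<ge> 0 \<and> Cr \<ge> 0 \<and> \<kappa>r \<ge> 0 \<and>
       is_max (resolvent_norms K) Cm \<and>
       is_max (kernel_quotients K) Cp \<and>
       is_max (reward_quotients r) Cr \<and>
       is_max (centered_reward_norms r) \<kappa>r \<and>
       (\<forall>\<pi>\<in>policies. \<forall>\<pi>'\<in>policies.
          has_second_dir_deriv (average_reward K r) \<pi> \<pi>' \<and>
          \<bar>second_dir_deriv (average_reward K r) \<pi> \<pi>'\<bar>
            \<le> 4 * (Cp^2 * Cm^2 * \<kappa>r + Cp * Cm * Cr
                   + (Cp + 1) * (Cm^2 * Cp * \<kappa>r + Cm * Cr)
                   + 4 * (Cm^3 * Cp^2 * \<kappa>r + Cm^2 * Cp * Cr))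
              / 2 * (norm (\<pi>' - \<pi>))^2))"
proof -
  interpret ergodic_mdp K r by unfold_locales (use ergodic in blast)
  obtain Cm where Cm: "is_max (resolvent_norms K) Cm"
    using compact_image_is_max[OF compact_policies
        continuous_on_opnorm_inf[OF continuous_on_resolvent_inv]]
    unfolding resolvent_norms_def image_def by (auto simp: Setcompr_eq_image image_def)
  obtain Cp where Cp: "is_max (kernel_quotients K) Cp"
    unfolding kernel_quotients_eq
    using compact_image_is_max[OF compact_tangent_sphere
        continuous_on_opnorm_inf[OF continuous_on_policy_kernel]] .
  obtain Cr where Cr: "is_max (reward_quotients r) Cr"
    unfolding reward_quotients_eq
    using compact_image_is_max[OF compact_tangent_sphere
        continuous_on_infnorm[OF continuous_on_policy_reward]] .
  obtain \<kappa>r where \<kappa>r: "is_max (centered_reward_norms r) \<kappa>r"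
    using compact_image_is_max[OF compact_policies continuous_on_infnorm[OF
          continuous_on_matrix_vector_mult[OF continuous_on_const continuous_on_policy_reward]],
        of centering r]
    unfolding centered_reward_norms_def by (auto simp: Setcompr_eq_image image_def)
  have nonneg: "0 \<le> Cm" "0 \<le> Cp" "0 \<le> Cr" "0 \<le> \<kappa>r"
    by (rule is_max_nonneg[OF Cm] is_max_nonneg[OF Cp] is_max_nonneg[OF Cr] is_max_nonneg[OF \<kappa>r],
        auto simp: resolvent_norms_def kernel_quotients_def reward_quotients_def
          centered_reward_norms_def opnorm_inf_nonneg infnorm_pos_le)+
  have bound: "\<bar>second_dir_deriv (average_reward K r) \<pi> \<pi>'\<bar>
      \<le> 4 * Cp * Cm * (Cp * Cm * \<kappa>r + Cr) * (norm (\<pi>' - \<pi>))\<^sup>2"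
    if \<pi>: "\<pi> \<in> policies" and \<pi>': "\<pi>' \<in> policies" for \<pi> \<pi>'
  proof -
    define u where "u = \<pi>' - \<pi>"
    have P: "opnorm_inf (P u) \<le> Cp * norm u" and R: "infnorm (R u) \<le> Cr * norm u"
    proof -
      show "opnorm_inf (P u) \<le> Cp * norm u"
      \<comment> \<open>The difference quotients range over distinct policies only, so equal
        policies are treated separately.\<close>
      proof (cases "u = 0")
        case True
        then show ?thesis
          using opnorm_inf_scaleR[of 0 "0::real^'s^'s"]
          by (simp add: linear_0[OF linear_policy_kernel])
      next
        case False
        then have "opnorm_inf (P u) / norm u \<le> Cp"
          using \<pi> \<pi>' unfolding u_def linear_diff[OF linear_policy_kernel]
          by (intro is_max_upper[OF Cp]) (auto simp: kernel_quotients_def)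
        with False show ?thesis by (simp add: divide_le_eq)
      qed
      show "infnorm (R u) \<le> Cr * norm u"
      proof (cases "u = 0")
        case True
        then show ?thesis by (simp add: linear_0[OF linear_policy_reward] infnorm_0)
      next
        case False
        then have "infnorm (R u) / norm u \<le> Cr"
          using \<pi> \<pi>' unfolding u_def linear_diff[OF linear_policy_reward]
          by (intro is_max_upper[OF Cr]) (auto simp: reward_quotients_def)
        with False show ?thesis by (simp add: divide_le_eq)
      qed
    qed
    have Pmul: "infnorm (P u *v x) \<le> Cp * norm u * infnorm x" for x
      by (intro order_trans[OF infnorm_mult_le] mult_right_mono P infnorm_pos_le)
    have M: "opnorm_inf (matrix_inv (mat 1 - centering ** P \<pi>)) \<le> Cm"
      using \<pi> by (intro is_max_upper[OF Cm]) (auto simp: resolvent_norms_def)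
    have "infnorm (centering *v R \<pi>) \<le> \<kappa>r"
      using \<pi> by (intro is_max_upper[OF \<kappa>r]) (auto simp: centered_reward_norms_def)
    \<comment> \<open>The reward enters \<open>bias\<close> only after centering, so
      \<open>\<kappa>r\<close> bounds it directly.\<close>
    then have "infnorm (bias (P \<pi>) (R \<pi>)) \<le> Cm * \<kappa>r"
      by (intro order_trans[OF bias_bound[OF M]] mult_left_mono nonneg)
    then have "infnorm (P u *v bias (P \<pi>) (R \<pi>)) \<le> Cp * norm u * (Cm * \<kappa>r)"
      by (intro order_trans[OF Pmul] mult_left_mono) (use nonneg in auto)
    then have adv: "infnorm (advantage u \<pi>) \<le> (Cp * Cm * \<kappa>r + Cr) * norm u"
      using infnorm_triangle[of "P u *v bias (P \<pi>) (R \<pi>)" "R u"] R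
      by (simp add: advantage_def algebra_simps)
    have "\<bar>second_dir_deriv (average_reward K r) \<pi> \<pi>'\<bar>
        = 2 * \<bar>d \<pi> \<bullet> (P u *v bias (P \<pi>) (advantage u \<pi>))\<bar>"
      using second_derivative(2)[OF \<pi> \<pi>'] by (simp add: u_def abs_mult)
    also have "\<dots> \<le> 2 * infnorm (P u *v bias (P \<pi>) (advantage u \<pi>))"
      using stationary_abs_le[OF ergodic_chain.stationary[OF ergodic_mdp.ergodic[OF ergodic_mdp_axioms \<pi>]]]
      by simp
    also have "\<dots> \<le> 2 * (Cp * norm u * infnorm (bias (P \<pi>) (advantage u \<pi>)))"
      using Pmul by simp
    \<comment> \<open>The advantage is bounded before centering, which costs a second factor
      2.\<close>
    also have "\<dots> \<le> 2 * (Cp * norm u * (Cm * (2 * ((Cp * Cm * \<kappa>r + Cr) * norm u))))"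
      by (intro mult_left_mono order_trans[OF bias_bound[OF M]]
          order_trans[OF infnorm_centering_le] adv) (use nonneg in auto)
    finally show ?thesis by (simp add: u_def power2_eq_square algebra_simps)
  qed
  \<comment> \<open>The \<open>Cp\<close> part of the factor \<open>Cp + 1\<close> repeats the first
    two terms. Half of the claimed constant is therefore the left-hand side plus nonnegative
    terms.\<close>
  have "4 * Cp * Cm * (Cp * Cm * \<kappa>r + Cr)
      \<le> 4 * (Cp^2 * Cm^2 * \<kappa>r + Cp * Cm * Cr
                   + (Cp + 1) * (Cm^2 * Cp * \<kappa>r + Cm * Cr)
                   + 4 * (Cm^3 * Cp^2 * \<kappa>r + Cm^2 * Cp * Cr)) / 2"
  proof -
    have "0 \<le> Cm^2 * Cp * \<kappa>r + Cm * Cr + 4 * (Cm^3 * Cp^2 * \<kappa>r + Cm^2 * Cp * Cr)"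
      using nonneg by simp
    then show ?thesis by (simp add: algebra_simps power2_eq_square)
  qed
  then have "\<forall>\<pi>\<in>policies. \<forall>\<pi>'\<in>policies.
      has_second_dir_deriv (average_reward K r) \<pi> \<pi>' \<and>
      \<bar>second_dir_deriv (average_reward K r) \<pi> \<pi>'\<bar>
        \<le> 4 * (Cp^2 * Cm^2 * \<kappa>r + Cp * Cm * Cr
                   + (Cp + 1) * (Cm^2 * Cp * \<kappa>r + Cm * Cr)
                   + 4 * (Cm^3 * Cp^2 * \<kappa>r + Cm^2 * Cp * Cr))
              / 2 * (norm (\<pi>' - \<pi>))^2"
    by (intro ballI conjI second_derivative(1) order_trans[OF bound] mult_right_mono) auto
  moreover have "invertible (mat 1 - centering ** policy_kernel K \<pi>)" if "\<pi> \<in> policies" for \<pi>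
    by (intro ergodic_chain.invertible ergodic_mdp.ergodic[OF ergodic_mdp_axioms] that)
  ultimately show ?thesis
    using Cm Cp Cr \<kappa>r nonneg by blast
qed

end
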